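(* For every integer $n \geq 1$ and every real $x$, $$\frac{\widehat{c}_n(x)}{n!} = \binom{x}{n} + \sum_{m=0}^{n-1} \frac{\widehat{c}_m(x)}{m!}\, \frac{(-1)^{n-m}}{(n-m)(n+1-m)}.$$
   Context: For real $z$ and integer $n\ge 0$, $\binom{z}{n} = \frac{z(z-1)\cdots(z-n+1)}{n!}$ (with $\binom{z}{0}=1$). The Cauchy polynomials of the second kind are $\widehat{c}_n(x) = n! \int_{0}^{1} \binom{x - t}{n}\, dt$ for $n \ge 0$ (equivalently, $\frac{t(1+t)^x}{(1+t)\ln(1+t)} = \sum_{n\ge 0} \widehat{c}_n(x)\frac{t^n}{n!}$ for $|t|<1$). *)

theory Defs
  imports "HOL-Analysis.Analysis"
begin

definition cauchy_poly2 :: "nat \<Rightarrow> real \<Rightarrow> real" where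
  "cauchy_poly2 n x = fact n * integral {0..1} (\<lambda>t. (x - t) gchoose n)"

end

theory Submission
  imports Defs
begin

text \<open>
  The function \<open>t \<mapsto> - ((x + 1 - t) gchoose (n + 1))\<close> is an antiderivative of the combination of
  binomials \<open>(x - t) gchoose m\<close> that the recurrence integrates; by Pascal's rule its increment
  over \<open>[0, 1]\<close> is \<open>x gchoose n\<close>. In terms of generating functions, this is
  \<open>d/dy (1 + u) powr (y + 1) = (1 + u) ln (1 + u) (1 + u) powr y\<close>, where
  \<open>(1 + u) ln (1 + u) / u\<close> has the coefficients \<open>(-1) ^ (k + 1) / (k (k + 1))\<close> for \<open>k \<ge> 1\<close>.
\<close>

text \<open>The weights are the coefficients of \<open>ln (1 + u)\<close>, since d/dy of
  \<open>(1 + u) powr y\<close> is \<open>ln (1 + u)\<close> times itself. The induction avoids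
  power series, using only the product rule and the recurrence \<open>rec\<close>.\<close>

lemma gbinomial_has_real_derivative:
  fixes y :: real
  shows "((\<lambda>y. y gchoose n) has_real_derivative
    (\<Sum>k<n. (- 1) ^ k / real (Suc k) * (y gchoose (n - Suc k)))) (at y)"
proof (induction n)
  case 0
  show ?case by simp
next
  case (Suc n)
  define S where "S = (\<Sum>k<n. (- 1) ^ k / real (Suc k) * (y gchoose (n - Suc k)))"
  have rec: "(z - real m) * (z gchoose m) = real (Suc m) * (z gchoose Suc m)" for z :: real and m
    by (simp add: gbinomial_mult_1 algebra_simps)
  \<comment> \<open>Split \<open>y - n\<close> as \<open>(y - (n - Suc k)) - Suc k\<close>; by
    \<open>rec\<close> the first part raises the lower index.\<close>
  have "(y - real n) * S = (\<Sum>k<n. (- 1) ^ k / real (Suc k) *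
      (real (n - k) * (y gchoose (n - k)) - real (Suc k) * (y gchoose (n - Suc k))))"
    unfolding S_def sum_distrib_left
  proof (rule sum.cong)
    fix k assume "k \<in> {..<n}"
    then have "n - k = Suc (n - Suc k)" "real n = real (n - Suc k) + real (Suc k)" by auto
    then have "(y - real n) * (y gchoose (n - Suc k)) =
        real (n - k) * (y gchoose (n - k)) - real (Suc k) * (y gchoose (n - Suc k))"
      using rec[of y "n - Suc k"] by (simp add: algebra_simps)
    then show "(y - real n) * ((- 1) ^ k / real (Suc k) * (y gchoose (n - Suc k))) =
      (- 1) ^ k / real (Suc k) *
        (real (n - k) * (y gchoose (n - k)) - real (Suc k) * (y gchoose (n - Suc k)))"
      by (metis mult.left_commute)
  qed simp
  \<comment> \<open>Here \<open>n - k = Suc n - Suc k\<close> turns the quotient by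
    \<open>Suc k\<close> into \<open>Suc n / Suc k - 1\<close>.\<close>
  also have "\<dots> = (\<Sum>k<n. real (Suc n) * ((- 1) ^ k / real (Suc k) * (y gchoose (n - k)))
      - (- 1) ^ k * (y gchoose (n - k)) - (- 1) ^ k * (y gchoose (n - Suc k)))"
    by (rule sum.cong) (auto simp: field_simps of_nat_diff)
  also have "\<dots> = real (Suc n) * (\<Sum>k<n. (- 1) ^ k / real (Suc k) * (y gchoose (n - k)))
      - (\<Sum>k<n. (- 1) ^ k * (y gchoose (n - k))) + (\<Sum>k<n. (- 1) ^ Suc k * (y gchoose (n - Suc k)))"
    by (simp add: sum_subtractf sum_distrib_left sum_negf)
  \<comment> \<open>The index shift cancels the alternating sums. The leftover
    \<open>(- 1) ^ n\<close> supplies the summand \<open>k = n\<close> of the target.\<close>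
  also have "(\<Sum>k<n. (- 1) ^ Suc k * (y gchoose (n - Suc k))) =
      (\<Sum>k<n. (- 1) ^ k * (y gchoose (n - k))) + (- 1) ^ n - (y gchoose n)"
    using sum.lessThan_Suc_shift[of "\<lambda>k. (- 1) ^ k * (y gchoose (n - k))" n] by simp
  finally have "(y - real n) * S + (y gchoose n) =
      real (Suc n) * (\<Sum>k<Suc n. (- 1) ^ k / real (Suc k) * (y gchoose (Suc n - Suc k)))"
    by (simp add: distrib_left)
  moreover have "((\<lambda>z. (z - real n) * (z gchoose n) / real (Suc n)) has_real_derivative
      ((y - real n) * S + (y gchoose n)) / real (Suc n)) (at y)"
    using Suc.IH unfolding S_def[symmetric]
    by (intro DERIV_cdivide) (auto intro!: derivative_eq_intros simp: algebra_simps)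
  moreover have "(\<lambda>z. (z - real n) * (z gchoose n) / real (Suc n)) = (\<lambda>z. z gchoose Suc n)"
    unfolding rec by simp
  ultimately show ?case by simp
qed

lemma gbinomial_add_one_has_real_derivative:
  fixes y :: real
  shows "((\<lambda>y. (y + 1) gchoose Suc n) has_real_derivative
    (y gchoose n) -
    (\<Sum>m<n. (y gchoose m) * ((- 1) ^ (n - m) / (real (n - m) * real (n + 1 - m))))) (at y)"
proof -
  have "(\<lambda>y::real. (y + 1) gchoose Suc n) = (\<lambda>y. (y gchoose n) + (y gchoose Suc n))"
    by (simp add: gbinomial_Suc_Suc)
  moreover have "((\<lambda>y. (y gchoose n) + (y gchoose Suc n)) has_real_derivative
      (\<Sum>k<n. (- 1) ^ k / real (Suc k) * (y gchoose (n - Suc k))) +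
      (\<Sum>k<Suc n. (- 1) ^ k / real (Suc k) * (y gchoose (Suc n - Suc k)))) (at y)"
    by (intro DERIV_add gbinomial_has_real_derivative)
  \<comment> \<open>The term \<open>k = 0\<close> of the longer sum is split off; shifting the rest
    aligns the binomials.\<close>
  moreover have "(\<Sum>k<n. (- 1) ^ k / real (Suc k) * (y gchoose (n - Suc k))) +
      (\<Sum>k<Suc n. (- 1) ^ k / real (Suc k) * (y gchoose (Suc n - Suc k))) =
      (y gchoose n) + (\<Sum>k<n. ((- 1) ^ k / real (Suc k) + (- 1) ^ Suc k / real (Suc (Suc k)))
        * (y gchoose (n - Suc k)))"
    unfolding sum.lessThan_Suc_shift by (simp add: left_diff_distrib sum_subtractf sum_negf)
  \<comment> \<open>Put \<open>m = n - Suc k\<close> and use 1/(k+1) - 1/(k+2) = 1/((k+1)(k+2)); the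
    minus sign comes from \<open>n - m = Suc k\<close>.\<close>
  moreover have "(\<Sum>k<n. ((- 1) ^ k / real (Suc k) + (- 1) ^ Suc k / real (Suc (Suc k)))
        * (y gchoose (n - Suc k))) =
      (\<Sum>m<n. - ((y gchoose m) * ((- 1) ^ (n - m) / (real (n - m) * real (n + 1 - m)))))"
  proof (rule sum.reindex_bij_witness[of _ "\<lambda>m. n - Suc m" "\<lambda>k. n - Suc k"])
    fix k assume k: "k \<in> {..<n}"
    then have "n - (n - Suc k) = Suc k" "n + 1 - (n - Suc k) = Suc (Suc k)" by auto
    then show "- ((y gchoose (n - Suc k)) *
        ((- 1) ^ (n - (n - Suc k)) / (real (n - (n - Suc k)) * real (n + 1 - (n - Suc k))))) =
      ((- 1) ^ k / real (Suc k) + (- 1) ^ Suc k / real (Suc (Suc k))) * (y gchoose (n - Suc k))"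
      by (simp add: divide_simps) (simp add: algebra_simps)
  qed auto
  ultimately show ?thesis by (simp add: sum_negf)
qed

text \<open>Differentiability gives continuity, so \<open>integral\<close> is a genuine value here
  and not a default.\<close>

lemma cauchy_poly2_has_integral:
  "((\<lambda>t. (x - t) gchoose n) has_integral cauchy_poly2 n x / fact n) {0..1}"
proof -
  have "isCont (\<lambda>y::real. y gchoose n) y" for y
    by (rule DERIV_isCont[OF gbinomial_has_real_derivative])
  then have "continuous_on UNIV (\<lambda>y::real. y gchoose n)"
    by (simp add: continuous_on_eq_continuous_at)
  then have "continuous_on {0..1} (\<lambda>t. (x - t) gchoose n)"
    by (rule continuous_on_compose2) (auto intro!: continuous_intros)
  then show ?thesis
    by (simp add: cauchy_poly2_def integrable_integral integrable_continuous_real)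
qed

theorem mainTheorem1:
  fixes n :: nat and x :: real
  assumes "n \<ge> 1"
  shows "cauchy_poly2 n x / fact n =
    (x gchoose n) +
    (\<Sum>m = 0..n - 1. cauchy_poly2 m x / fact m *
       ((- 1) ^ (n - m) / (real (n - m) * real (n + 1 - m))))"
proof -
  define a where "a m = (- 1) ^ (n - m) / (real (n - m) * real (n + 1 - m))" for m
  \<comment> \<open>The outer minus cancels the inner derivative -1 of \<open>x - t\<close>.\<close>
  have "((\<lambda>t. - ((x - t + 1) gchoose Suc n)) has_real_derivative
      ((x - t) gchoose n) - (\<Sum>m<n. ((x - t) gchoose m) * a m)) (at t)" for t
  proof -
    have "((\<lambda>t. x - t) has_real_derivative - 1) (at t)"
      by (auto intro!: derivative_eq_intros)
    from DERIV_minus[OF DERIV_chain2[OF gbinomial_add_one_has_real_derivative this]]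
    show ?thesis by (simp add: a_def)
  qed
  then have "((\<lambda>t. ((x - t) gchoose n) - (\<Sum>m<n. ((x - t) gchoose m) * a m)) has_integral
      - ((x - 1 + 1) gchoose Suc n) - - ((x - 0 + 1) gchoose Suc n)) {0..1}"
    by (intro fundamental_theorem_of_calculus)
      (auto simp: has_real_derivative_iff_has_vector_derivative[symmetric]
        intro: has_field_derivative_at_within)
  moreover have "((\<lambda>t. ((x - t) gchoose n) - (\<Sum>m<n. ((x - t) gchoose m) * a m)) has_integral
      cauchy_poly2 n x / fact n - (\<Sum>m<n. cauchy_poly2 m x / fact m * a m)) {0..1}"
    by (intro has_integral_diff has_integral_sum has_integral_mult_left
        cauchy_poly2_has_integral finite_lessThan)
  ultimately have "cauchy_poly2 n x / fact n - (\<Sum>m<n. cauchy_poly2 m x / fact m * a m) =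
      - ((x - 1 + 1) gchoose Suc n) - - ((x - 0 + 1) gchoose Suc n)"
    by (rule has_integral_unique[symmetric])
  also have "\<dots> = x gchoose n"
    by (simp add: gbinomial_Suc_Suc)
  finally have "cauchy_poly2 n x / fact n =
      (x gchoose n) + (\<Sum>m<n. cauchy_poly2 m x / fact m * a m)"
    by simp
  \<comment> \<open>For \<open>n = 0\<close> truncated subtraction would make the right side
    \<open>{0}\<close>.\<close>
  moreover have "{..<n} = {0..n - 1}"
    using assms by auto
  ultimately show ?thesis by (simp add: a_def)
qed

end
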